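(* Let $A$ be a finite (not necessarily associative) ring. The equality $\mathrm{pot}\,A=|A|$ holds if and only if $A$ is a prime ring. Moreover, if $A$ is a prime ring, then there exist positive constants $c_1$ and $c_2$ such that $c_1|A|^n<\log|F_n|<c_2|A|^n$ for all $n\ge1$, where $F_n$ is the $n$-generated free ring in the variety $\mathrm{var}\,A$.
   Context: Rings are not assumed to be associative, commutative or to have an identity element: a ring is an abelian group under addition with a biadditive multiplication, and there is no symbol for $1$ in the signature. For a finite ring $A$, $\mathrm{var}\,A$ denotes the variety generated by $A$, i.e. the class of all (not necessarily associative) rings satisfying every identity that holds in $A$. For $n\ge1$, $F_n$ denotes the free ring on $n$ free generators in the variety $\mathrm{var}\,A$; it is finite, with $|F_n|\le|A|^{|A|^n}$. The potential of $A$ is $\mathrm{pot}\,A=\limsup_{n\to\infty}\sqrt[n]{\log|F_n|}$. Ideals are two-sided. A nonzero ring $A$ is called prime if the product of any two nonzero ideals $I,J$ of $A$ is nonzero (i.e. $ab\neq0$ for some $a\in I$, $b\in J$). *)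

theory Defs
  imports Complex_Main "HOL-Algebra.AbelCoset" "HOL-Library.Extended_Real"
begin

section \<open>Rings without associativity, commutativity or identity\<close>

text \<open>
  The record type \<open>ring\<close> of HOL-Algebra is reused as the signature. Its field \<open>one\<close> (and any
  extension fields) is never referred to: no definition below depends on it.
\<close>

locale nonassoc_ring = abelian_group R for R (structure) +
  assumes m_closed [intro, simp]:
      "\<lbrakk>x \<in> carrier R; y \<in> carrier R\<rbrakk> \<Longrightarrow> x \<otimes> y \<in> carrier R"
    and l_distr: "\<lbrakk>x \<in> carrier R; y \<in> carrier R; z \<in> carrier R\<rbrakk> \<Longrightarrow>
      (x \<oplus> y) \<otimes> z = x \<otimes> z \<oplus> y \<otimes> z"
    and r_distr: "\<lbrakk>x \<in> carrier R; y \<in> carrier R; z \<in> carrier R\<rbrakk> \<Longrightarrow>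
      z \<otimes> (x \<oplus> y) = z \<otimes> x \<oplus> z \<otimes> y"

definition nonassoc_ideal :: "'a set \<Rightarrow> ('a, 'm) ring_scheme \<Rightarrow> bool" where
  "nonassoc_ideal I R \<longleftrightarrow> additive_subgroup I R \<and>
     (\<forall>a\<in>I. \<forall>x\<in>carrier R. x \<otimes>\<^bsub>R\<^esub> a \<in> I \<and> a \<otimes>\<^bsub>R\<^esub> x \<in> I)"

definition nonassoc_prime :: "('a, 'm) ring_scheme \<Rightarrow> bool" where
  "nonassoc_prime R \<longleftrightarrow> nonassoc_ring R \<and> carrier R \<noteq> {\<zero>\<^bsub>R\<^esub>} \<and>
     (\<forall>I J. nonassoc_ideal I R \<and> I \<noteq> {\<zero>\<^bsub>R\<^esub>} \<and> nonassoc_ideal J R \<and> J \<noteq> {\<zero>\<^bsub>R\<^esub>} \<longrightarrow>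
        (\<exists>a\<in>I. \<exists>b\<in>J. a \<otimes>\<^bsub>R\<^esub> b \<noteq> \<zero>\<^bsub>R\<^esub>))"

definition nonassoc_ring_hom ::
  "('a, 'm) ring_scheme \<Rightarrow> ('b, 'k) ring_scheme \<Rightarrow> ('a \<Rightarrow> 'b) set" where
  "nonassoc_ring_hom R S = {h \<in> carrier R \<rightarrow> carrier S. \<forall>x\<in>carrier R. \<forall>y\<in>carrier R.
     h (x \<oplus>\<^bsub>R\<^esub> y) = h x \<oplus>\<^bsub>S\<^esub> h y \<and> h (x \<otimes>\<^bsub>R\<^esub> y) = h x \<otimes>\<^bsub>S\<^esub> h y}"


section \<open>Identities and the variety generated by a ring\<close>

datatype rterm = TVar nat | TZero | TNeg rterm | TAdd rterm rterm | TMult rterm rterm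

primrec tvars :: "rterm \<Rightarrow> nat set" where
  "tvars (TVar i) = {i}"
| "tvars TZero = {}"
| "tvars (TNeg t) = tvars t"
| "tvars (TAdd s t) = tvars s \<union> tvars t"
| "tvars (TMult s t) = tvars s \<union> tvars t"

primrec teval :: "('a, 'm) ring_scheme \<Rightarrow> (nat \<Rightarrow> 'a) \<Rightarrow> rterm \<Rightarrow> 'a" where
  "teval R \<rho> (TVar i) = \<rho> i"
| "teval R \<rho> TZero = \<zero>\<^bsub>R\<^esub>"
| "teval R \<rho> (TNeg t) = \<ominus>\<^bsub>R\<^esub> teval R \<rho> t"
| "teval R \<rho> (TAdd s t) = teval R \<rho> s \<oplus>\<^bsub>R\<^esub> teval R \<rho> t"
| "teval R \<rho> (TMult s t) = teval R \<rho> s \<otimes>\<^bsub>R\<^esub> teval R \<rho> t"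

definition holds_identity :: "('a, 'm) ring_scheme \<Rightarrow> rterm \<Rightarrow> rterm \<Rightarrow> bool" where
  "holds_identity R s t \<longleftrightarrow> (\<forall>\<rho> \<in> UNIV \<rightarrow> carrier R. teval R \<rho> s = teval R \<rho> t)"

definition in_var :: "('a, 'm) ring_scheme \<Rightarrow> ('b, 'k) ring_scheme \<Rightarrow> bool" where
  "in_var A B \<longleftrightarrow> nonassoc_ring B \<and> (\<forall>s t. holds_identity A s t \<longrightarrow> holds_identity B s t)"


section \<open>Free rings of the variety\<close>

text \<open>
  The free ring on \<open>n\<close> generators is the algebra of terms in the variables \<open>0, \<dots>, n - 1\<close> modulo
  the identities of the variety. An identity holds in all members of the variety generated by
  \<open>A\<close> iff it holds in \<open>A\<close>. The theorem \<open>var_free_ring_universal\<close> below is the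
  universal property that characterises this ring up to isomorphism.
\<close>

definition terms_upto :: "nat \<Rightarrow> rterm set" where
  "terms_upto n = {t. tvars t \<subseteq> {..<n}}"

definition identity_rel :: "('a, 'm) ring_scheme \<Rightarrow> nat \<Rightarrow> (rterm \<times> rterm) set" where
  "identity_rel A n = {(s, t). s \<in> terms_upto n \<and> t \<in> terms_upto n \<and> holds_identity A s t}"

definition var_free_ring :: "('a, 'm) ring_scheme \<Rightarrow> nat \<Rightarrow> rterm set ring" where
  "var_free_ring A n =
     \<lparr> carrier = terms_upto n // identity_rel A n,
       mult = (\<lambda>X Y. \<Union>s\<in>X. \<Union>t\<in>Y. identity_rel A n `` {TMult s t}),
       one = undefined,
       zero = identity_rel A n `` {TZero},
       add = (\<lambda>X Y. \<Union>s\<in>X. \<Union>t\<in>Y. identity_rel A n `` {TAdd s t}) \<rparr>"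

definition var_free_gen :: "('a, 'm) ring_scheme \<Rightarrow> nat \<Rightarrow> nat \<Rightarrow> rterm set" where
  "var_free_gen A n i = identity_rel A n `` {TVar i}"

definition pot :: "('a, 'm) ring_scheme \<Rightarrow> ereal" where
  "pot A = limsup (\<lambda>n. ereal (root n (ln (real (card (carrier (var_free_ring A n)))))))"


section \<open>The construction has the properties of a relatively free ring\<close>

lemma (in nonassoc_ring) teval_closed:
  "\<rho> \<in> tvars t \<rightarrow> carrier R \<Longrightarrow> teval R \<rho> t \<in> carrier R"
  by (induction t) auto

lemma teval_cong: "(\<And>i. i \<in> tvars t \<Longrightarrow> \<rho> i = \<sigma> i) \<Longrightarrow> teval R \<rho> t = teval R \<sigma> t"
  by (induction t) auto

lemma holds_identity_D:
  "holds_identity R s t \<Longrightarrow> (\<And>i. \<rho> i \<in> carrier R) \<Longrightarrow> teval R \<rho> s = teval R \<rho> t"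
  by (auto simp: holds_identity_def)

lemma equiv_identity_rel: "equiv (terms_upto n) (identity_rel A n)"
  by (rule equivI) (auto simp: identity_rel_def holds_identity_def refl_on_def sym_def trans_def)

lemma terms_upto_simps [simp]:
  "TZero \<in> terms_upto n"
  "TVar i \<in> terms_upto n \<longleftrightarrow> i < n"
  "TNeg s \<in> terms_upto n \<longleftrightarrow> s \<in> terms_upto n"
  "TAdd s t \<in> terms_upto n \<longleftrightarrow> s \<in> terms_upto n \<and> t \<in> terms_upto n"
  "TMult s t \<in> terms_upto n \<longleftrightarrow> s \<in> terms_upto n \<and> t \<in> terms_upto n"
  by (auto simp: terms_upto_def)

lemma class_eq_iff:
  assumes "s \<in> terms_upto n" "t \<in> terms_upto n"
  shows "identity_rel A n `` {s} = identity_rel A n `` {t} \<longleftrightarrow> holds_identity A s t"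
  using eq_equiv_class_iff[OF equiv_identity_rel assms, of A] assms by (simp add: identity_rel_def)

lemma UN_UN_constant:
  assumes "x \<in> X" "y \<in> Y" "\<And>s t. s \<in> X \<Longrightarrow> t \<in> Y \<Longrightarrow> f s t = c"
  shows "(\<Union>s\<in>X. \<Union>t\<in>Y. f s t) = c"
  using assms by auto

lemma class_add:
  assumes "s \<in> terms_upto n" "t \<in> terms_upto n"
  shows "identity_rel A n `` {s} \<oplus>\<^bsub>var_free_ring A n\<^esub> identity_rel A n `` {t} =
    identity_rel A n `` {TAdd s t}"
proof -
  have cong: "identity_rel A n `` {TAdd s' t'} = identity_rel A n `` {TAdd s t}"
    if "(s, s') \<in> identity_rel A n" "(t, t') \<in> identity_rel A n" for s' t'
    using that assms by (subst class_eq_iff) (auto simp: identity_rel_def holds_identity_def)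
  have refl: "(s, s) \<in> identity_rel A n" "(t, t) \<in> identity_rel A n"
    using assms by (auto simp: identity_rel_def holds_identity_def)
  have "(\<Union>s'\<in>identity_rel A n `` {s}. \<Union>t'\<in>identity_rel A n `` {t}.
      identity_rel A n `` {TAdd s' t'}) = identity_rel A n `` {TAdd s t}"
    by (rule UN_UN_constant[of s _ t])
      ((rule cong; simp only: Image_singleton_iff) | simp only: Image_singleton_iff refl)+
  then show ?thesis by (simp add: var_free_ring_def)
qed

lemma class_mult:
  assumes "s \<in> terms_upto n" "t \<in> terms_upto n"
  shows "identity_rel A n `` {s} \<otimes>\<^bsub>var_free_ring A n\<^esub> identity_rel A n `` {t} =
    identity_rel A n `` {TMult s t}"
proof -
  have cong: "identity_rel A n `` {TMult s' t'} = identity_rel A n `` {TMult s t}"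
    if "(s, s') \<in> identity_rel A n" "(t, t') \<in> identity_rel A n" for s' t'
    using that assms by (subst class_eq_iff) (auto simp: identity_rel_def holds_identity_def)
  have refl: "(s, s) \<in> identity_rel A n" "(t, t) \<in> identity_rel A n"
    using assms by (auto simp: identity_rel_def holds_identity_def)
  have "(\<Union>s'\<in>identity_rel A n `` {s}. \<Union>t'\<in>identity_rel A n `` {t}.
      identity_rel A n `` {TMult s' t'}) = identity_rel A n `` {TMult s t}"
    by (rule UN_UN_constant[of s _ t])
      ((rule cong; simp only: Image_singleton_iff) | simp only: Image_singleton_iff refl)+
  then show ?thesis by (simp add: var_free_ring_def)
qed

lemma class_zero: "\<zero>\<^bsub>var_free_ring A n\<^esub> = identity_rel A n `` {TZero}"
  by (simp add: var_free_ring_def)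

lemma class_closed:
  "s \<in> terms_upto n \<Longrightarrow> identity_rel A n `` {s} \<in> carrier (var_free_ring A n)"
  by (simp add: var_free_ring_def quotientI)

lemma classE:
  assumes "X \<in> carrier (var_free_ring A n)"
  obtains s where "s \<in> terms_upto n" "X = identity_rel A n `` {s}"
  using assms by (auto simp: var_free_ring_def elim: quotientE)

lemma nonassoc_ring_var_free_ring:
  assumes "nonassoc_ring A"
  shows "nonassoc_ring (var_free_ring A n)"
proof -
  interpret nonassoc_ring A by fact
  let ?F = "var_free_ring A n"
  note [simp] = class_add class_mult class_zero class_closed class_eq_iff
  have ev [simp]: "teval A \<rho> t \<in> carrier A" if "\<rho> \<in> UNIV \<rightarrow> carrier A" for \<rho> t
    using that by (intro teval_closed) auto
  have ab: "abelian_group ?F"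
  proof (rule abelian_groupI)
    show "\<exists>Y\<in>carrier ?F. Y \<oplus>\<^bsub>?F\<^esub> X = \<zero>\<^bsub>?F\<^esub>" if X: "X \<in> carrier ?F" for X
      using X
    proof (rule classE)
      fix s assume s: "s \<in> terms_upto n" "X = identity_rel A n `` {s}"
      have "identity_rel A n `` {TNeg s} \<oplus>\<^bsub>?F\<^esub> X = \<zero>\<^bsub>?F\<^esub>"
        using s by (auto simp: holds_identity_def l_neg)
      then show ?thesis using s(1) by (meson class_closed terms_upto_simps(3))
    qed
  qed (auto del: equalityI elim!: classE simp: holds_identity_def a_ac)
  interpret F: abelian_group ?F by (rule ab)
  show ?thesis
    by unfold_locales (auto del: equalityI elim!: classE simp: holds_identity_def l_distr r_distr)
qed

lemma teval_var_free_ring: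
  assumes "nonassoc_ring A" and "\<And>i. \<sigma> i \<in> terms_upto n"
  shows "\<exists>u \<in> terms_upto n. teval (var_free_ring A n) (\<lambda>i. identity_rel A n `` {\<sigma> i}) t =
      identity_rel A n `` {u} \<and> (\<forall>\<rho>. teval A \<rho> u = teval A (\<lambda>i. teval A \<rho> (\<sigma> i)) t)"
proof (induction t)
  case (TVar i)
  then show ?case using assms(2) by (intro bexI[of _ "\<sigma> i"]) auto
next
  case TZero
  then show ?case by (intro bexI[of _ TZero]) (auto simp: class_zero)
next
  case (TAdd s t)
  then obtain u v where "u \<in> terms_upto n" "v \<in> terms_upto n"
    "teval (var_free_ring A n) (\<lambda>i. identity_rel A n `` {\<sigma> i}) s = identity_rel A n `` {u}"
    "teval (var_free_ring A n) (\<lambda>i. identity_rel A n `` {\<sigma> i}) t = identity_rel A n `` {v}"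
    "\<forall>\<rho>. teval A \<rho> u = teval A (\<lambda>i. teval A \<rho> (\<sigma> i)) s"
    "\<forall>\<rho>. teval A \<rho> v = teval A (\<lambda>i. teval A \<rho> (\<sigma> i)) t" by blast
  then show ?case by (intro bexI[of _ "TAdd u v"]) (auto simp: class_add)
next
  case (TMult s t)
  then obtain u v where "u \<in> terms_upto n" "v \<in> terms_upto n"
    "teval (var_free_ring A n) (\<lambda>i. identity_rel A n `` {\<sigma> i}) s = identity_rel A n `` {u}"
    "teval (var_free_ring A n) (\<lambda>i. identity_rel A n `` {\<sigma> i}) t = identity_rel A n `` {v}"
    "\<forall>\<rho>. teval A \<rho> u = teval A (\<lambda>i. teval A \<rho> (\<sigma> i)) s"
    "\<forall>\<rho>. teval A \<rho> v = teval A (\<lambda>i. teval A \<rho> (\<sigma> i)) t" by blast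
  then show ?case by (intro bexI[of _ "TMult u v"]) (auto simp: class_mult)
next
  case (TNeg t)
  interpret A: nonassoc_ring A by fact
  interpret F: nonassoc_ring "var_free_ring A n" by (rule nonassoc_ring_var_free_ring) fact
  obtain u where u: "u \<in> terms_upto n"
    "teval (var_free_ring A n) (\<lambda>i. identity_rel A n `` {\<sigma> i}) t = identity_rel A n `` {u}"
    "\<forall>\<rho>. teval A \<rho> u = teval A (\<lambda>i. teval A \<rho> (\<sigma> i)) t" using TNeg by blast
  have "teval A \<rho> u \<in> carrier A" if "\<rho> \<in> UNIV \<rightarrow> carrier A" for \<rho>
    using that by (intro A.teval_closed) auto
  then have "identity_rel A n `` {TNeg u} \<oplus>\<^bsub>var_free_ring A n\<^esub> identity_rel A n `` {u} =
      \<zero>\<^bsub>var_free_ring A n\<^esub>"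
    using u(1) by (auto simp: class_add class_zero class_eq_iff holds_identity_def A.l_neg)
  then have "\<ominus>\<^bsub>var_free_ring A n\<^esub> (identity_rel A n `` {u}) = identity_rel A n `` {TNeg u}"
    using u(1) by (intro F.minus_equality) (auto simp: class_closed)
  then show ?case using u by (intro bexI[of _ "TNeg u"]) auto
qed

theorem in_var_var_free_ring:
  assumes "nonassoc_ring A"
  shows "in_var A (var_free_ring A n)"
  unfolding in_var_def
proof (intro conjI allI impI)
  show "nonassoc_ring (var_free_ring A n)" by (rule nonassoc_ring_var_free_ring) fact
  interpret A: nonassoc_ring A by fact
  fix s t assume st: "holds_identity A s t"
  show "holds_identity (var_free_ring A n) s t"
    unfolding holds_identity_def
  proof
    fix \<tau> :: "nat \<Rightarrow> rterm set"
    assume "\<tau> \<in> UNIV \<rightarrow> carrier (var_free_ring A n)"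
    then have "\<forall>i. \<exists>u. u \<in> terms_upto n \<and> \<tau> i = identity_rel A n `` {u}"
      by (metis PiE UNIV_I classE)
    then obtain \<sigma> where \<sigma>: "\<And>i. \<sigma> i \<in> terms_upto n" "\<And>i. \<tau> i = identity_rel A n `` {\<sigma> i}"
      by metis
    then have \<tau>: "\<tau> = (\<lambda>i. identity_rel A n `` {\<sigma> i})" by auto
    obtain u v where uv: "u \<in> terms_upto n" "v \<in> terms_upto n"
      "teval (var_free_ring A n) \<tau> s = identity_rel A n `` {u}"
      "teval (var_free_ring A n) \<tau> t = identity_rel A n `` {v}"
      "\<And>\<rho>. teval A \<rho> u = teval A (\<lambda>i. teval A \<rho> (\<sigma> i)) s"
      "\<And>\<rho>. teval A \<rho> v = teval A (\<lambda>i. teval A \<rho> (\<sigma> i)) t"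
      using teval_var_free_ring[where \<sigma> = \<sigma>, OF assms \<sigma>(1)] unfolding \<tau> by metis
    have "holds_identity A u v"
      unfolding holds_identity_def uv(5,6)
      by (intro ballI holds_identity_D[OF st] A.teval_closed) auto
    then show "teval (var_free_ring A n) \<tau> s = teval (var_free_ring A n) \<tau> t"
      using uv by (simp add: class_eq_iff)
  qed
qed

lemma nonassoc_ring_hom_zero_neg:
  assumes "nonassoc_ring R" "nonassoc_ring S" "h \<in> nonassoc_ring_hom R S"
  shows "h \<zero>\<^bsub>R\<^esub> = \<zero>\<^bsub>S\<^esub>" "x \<in> carrier R \<Longrightarrow> h (\<ominus>\<^bsub>R\<^esub> x) = \<ominus>\<^bsub>S\<^esub> h x"
proof -
  interpret R: nonassoc_ring R by fact
  interpret S: nonassoc_ring S by fact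
  have cl: "h x \<in> carrier S" if "x \<in> carrier R" for x
    using assms(3) that by (auto simp: nonassoc_ring_hom_def)
  have add: "h (x \<oplus>\<^bsub>R\<^esub> y) = h x \<oplus>\<^bsub>S\<^esub> h y" if "x \<in> carrier R" "y \<in> carrier R" for x y
    using assms(3) that by (auto simp: nonassoc_ring_hom_def)
  show z: "h \<zero>\<^bsub>R\<^esub> = \<zero>\<^bsub>S\<^esub>"
    using add[of "\<zero>\<^bsub>R\<^esub>" "\<zero>\<^bsub>R\<^esub>"] cl[of "\<zero>\<^bsub>R\<^esub>"] by simp
  show "h (\<ominus>\<^bsub>R\<^esub> x) = \<ominus>\<^bsub>S\<^esub> h x" if "x \<in> carrier R"
    using add[of "\<ominus>\<^bsub>R\<^esub> x" x] that z cl by (intro S.minus_equality[symmetric]) (auto simp: R.l_neg)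
qed

lemma hom_teval:
  assumes "nonassoc_ring R" "nonassoc_ring S" "h \<in> nonassoc_ring_hom R S"
    and "\<rho> \<in> tvars t \<rightarrow> carrier R"
  shows "h (teval R \<rho> t) = teval S (\<lambda>i. h (\<rho> i)) t"
  using assms(4)
proof (induction t)
  case (TNeg t)
  then show ?case
    using nonassoc_ring_hom_zero_neg[OF assms(1-3)] nonassoc_ring.teval_closed[OF assms(1)]
    by auto
next
  case (TAdd s t)
  then have "\<rho> \<in> tvars s \<rightarrow> carrier R" "\<rho> \<in> tvars t \<rightarrow> carrier R" by auto
  then show ?case
    using TAdd.IH assms(3) nonassoc_ring.teval_closed[OF assms(1), of \<rho>]
    by (simp add: nonassoc_ring_hom_def)
next
  case (TMult s t)
  then have "\<rho> \<in> tvars s \<rightarrow> carrier R" "\<rho> \<in> tvars t \<rightarrow> carrier R" by auto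
  then show ?case
    using TMult.IH assms(3) nonassoc_ring.teval_closed[OF assms(1), of \<rho>]
    by (simp add: nonassoc_ring_hom_def)
qed (auto simp: nonassoc_ring_hom_zero_neg[OF assms(1-3)])

theorem var_free_ring_universal:
  assumes A: "nonassoc_ring A" and B: "in_var A B" and b: "\<And>i. i < n \<Longrightarrow> b i \<in> carrier B"
  shows "\<exists>h \<in> nonassoc_ring_hom (var_free_ring A n) B. \<forall>i<n. h (var_free_gen A n i) = b i"
    and "\<lbrakk>h \<in> nonassoc_ring_hom (var_free_ring A n) B; h' \<in> nonassoc_ring_hom (var_free_ring A n) B;
      \<forall>i<n. h (var_free_gen A n i) = b i; \<forall>i<n. h' (var_free_gen A n i) = b i;
      X \<in> carrier (var_free_ring A n)\<rbrakk> \<Longrightarrow> h X = h' X"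
proof -
  interpret B: nonassoc_ring B using B by (simp add: in_var_def)
  define \<beta> where "\<beta> = (\<lambda>i. if i < n then b i else \<zero>\<^bsub>B\<^esub>)"
  have \<beta>: "\<beta> i \<in> carrier B" for i by (simp add: \<beta>_def b)
  define h where "h = (\<lambda>X. teval B \<beta> (SOME t. t \<in> X))"
  have h: "h (identity_rel A n `` {s}) = teval B \<beta> s" if "s \<in> terms_upto n" for s
  proof -
    have "s \<in> identity_rel A n `` {s}"
      using that by (auto simp: identity_rel_def holds_identity_def)
    then have "(SOME t. t \<in> identity_rel A n `` {s}) \<in> identity_rel A n `` {s}" by (rule someI)
    then have "holds_identity B s (SOME t. t \<in> identity_rel A n `` {s})"
      using B by (auto simp: identity_rel_def in_var_def)
    from holds_identity_D[OF this \<beta>] show ?thesis by (simp add: h_def)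
  qed
  have "h \<in> nonassoc_ring_hom (var_free_ring A n) B"
    unfolding nonassoc_ring_hom_def
    by (auto elim!: classE simp: class_add class_mult h \<beta> intro!: B.teval_closed)
  moreover have "\<forall>i<n. h (var_free_gen A n i) = b i"
    by (simp add: var_free_gen_def h \<beta>_def)
  ultimately show "\<exists>h \<in> nonassoc_ring_hom (var_free_ring A n) B. \<forall>i<n. h (var_free_gen A n i) = b i"
    by blast
next
  assume hom: "h \<in> nonassoc_ring_hom (var_free_ring A n) B" "h' \<in> nonassoc_ring_hom (var_free_ring A n) B"
    and gen: "\<forall>i<n. h (var_free_gen A n i) = b i" "\<forall>i<n. h' (var_free_gen A n i) = b i"
    and X: "X \<in> carrier (var_free_ring A n)"
  let ?F = "var_free_ring A n"
  have B': "nonassoc_ring B" using B by (simp add: in_var_def)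
  have F: "nonassoc_ring ?F" by (rule nonassoc_ring_var_free_ring[OF A])
  interpret FF: nonassoc_ring ?F by (rule F)
  have rep: "teval ?F (var_free_gen A n) s = identity_rel A n `` {s}" if "s \<in> terms_upto n" for s
    using that
  proof (induction s)
    case (TNeg s)
    interpret A: nonassoc_ring A by (rule A)
    have s: "s \<in> terms_upto n" using TNeg by simp
    have "teval A \<rho> s \<in> carrier A" if "\<rho> \<in> UNIV \<rightarrow> carrier A" for \<rho>
      using that by (intro A.teval_closed) auto
    then have "identity_rel A n `` {TNeg s} \<oplus>\<^bsub>?F\<^esub> identity_rel A n `` {s} = \<zero>\<^bsub>?F\<^esub>"
      using s by (auto simp: class_add class_zero class_eq_iff holds_identity_def A.l_neg)
    then have "\<ominus>\<^bsub>?F\<^esub> (identity_rel A n `` {s}) = identity_rel A n `` {TNeg s}"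
      using s by (intro FF.minus_equality) (auto simp: class_closed)
    then show ?case using TNeg by simp
  qed (auto simp: class_add class_mult class_zero var_free_gen_def)
  from X obtain s where s: "s \<in> terms_upto n" "X = identity_rel A n `` {s}" by (rule classE)
  have gc: "var_free_gen A n \<in> tvars s \<rightarrow> carrier ?F"
    using s(1) by (auto simp: terms_upto_def var_free_gen_def subset_iff intro!: class_closed)
  have "teval B (\<lambda>i. h (var_free_gen A n i)) s = teval B (\<lambda>i. h' (var_free_gen A n i)) s"
    using s(1) gen by (intro teval_cong) (auto simp: terms_upto_def)
  then show "h X = h' X"
    using hom_teval[OF F B' hom(1) gc] hom_teval[OF F B' hom(2) gc] rep[OF s(1)] s(2) by simp
qed

theorem var_free_ring_finite:
  assumes A: "nonassoc_ring A" and fin: "finite (carrier A)"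
  shows "finite (carrier (var_free_ring A n))"
    and "card (carrier (var_free_ring A n)) \<le> card (carrier A) ^ (card (carrier A) ^ n)"
proof -
  interpret nonassoc_ring A by (rule A)
  let ?F = "var_free_ring A n"
  let ?E = "{..<n} \<rightarrow>\<^sub>E carrier A"
  let ?G = "?E \<rightarrow>\<^sub>E carrier A"
  define val where "val = (\<lambda>s. restrict (\<lambda>\<rho>. teval A \<rho> s) ?E)"
  have holds: "holds_identity A s t"
    if st: "s \<in> terms_upto n" "t \<in> terms_upto n" and eq: "val s = val t" for s t
    unfolding holds_identity_def
  proof
    fix \<rho> :: "nat \<Rightarrow> 'a"
    assume \<rho>: "\<rho> \<in> UNIV \<rightarrow> carrier A"
    then have r: "restrict \<rho> {..<n} \<in> ?E" by auto
    have "teval A \<rho> u = teval A (restrict \<rho> {..<n}) u" if "u \<in> terms_upto n" for u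
      using that by (intro teval_cong) (auto simp: terms_upto_def)
    then show "teval A \<rho> s = teval A \<rho> t"
      using st fun_cong[OF eq, of "restrict \<rho> {..<n}"] r by (simp add: val_def)
  qed
  define g where "g = (\<lambda>f. identity_rel A n `` {SOME s. s \<in> terms_upto n \<and> val s = f})"
  have sub: "carrier ?F \<subseteq> g ` ?G"
  proof
    fix X assume "X \<in> carrier ?F"
    then obtain s where s: "s \<in> terms_upto n" "X = identity_rel A n `` {s}" by (rule classE)
    define s' where "s' = (SOME t. t \<in> terms_upto n \<and> val t = val s)"
    have s': "s' \<in> terms_upto n \<and> val s' = val s"
      unfolding s'_def by (rule someI[of _ s]) (simp add: s(1))
    then have "holds_identity A s' s" using s(1) holds by simp
    then have "g (val s) = X"
      using s s' class_eq_iff[of s' n s A] by (simp add: g_def flip: s'_def)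
    moreover have "val s \<in> ?G"
      unfolding val_def restrict_PiE_iff
    proof
      fix \<rho> assume "\<rho> \<in> ?E"
      then show "teval A \<rho> s \<in> carrier A"
        using s(1) by (intro teval_closed Pi_I) (auto simp: terms_upto_def PiE_iff subset_iff)
    qed
    ultimately show "X \<in> g ` ?G" by blast
  qed
  have fG: "finite ?G" using fin by (intro finite_PiE) auto
  then show "finite (carrier ?F)" using sub by (meson finite_imageI finite_subset)
  have "card (carrier ?F) \<le> card ?G"
    using sub fG by (meson card_image_le card_mono finite_imageI le_trans)
  also have "\<dots> = card (carrier A) ^ (card (carrier A) ^ n)"
    using fin by (simp add: card_PiE finite_PiE)
  finally show "card (carrier ?F) \<le> card (carrier A) ^ (card (carrier A) ^ n)" .
qed

end

theory Submission
  imports Defs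
begin

text \<open>
  Let \<open>q\<close> be the order of \<open>A\<close>. Elements of \<open>F\<^sub>n\<close> are the term functions
  \<open>A\<^sup>n \<rightarrow> A\<close>, so counting them is a question of interpolation: on how many points of \<open>A\<^sup>n\<close> can
  the values of a term be prescribed independently, and how many points determine a term?

  If \<open>A\<close> is prime, the terms vanishing on a set of points form an ideal \<open>V\<close> of the free ring, and if
  the coordinates of a point \<open>p\<close> exhaust \<open>A\<close>, the values of \<open>V\<close> at \<open>p\<close> form an ideal of \<open>A\<close>.
  Primeness says that a product of two such nonzero ideals is nonzero, so terms that separate \<open>p\<close>
  from other points one at a time multiply to a term that separates \<open>p\<close> from all of them together
  (\<open>prime_isolating_term\<close>). Sums of such terms have arbitrary support on a set \<open>P\<close> of
  pairwise separated points, which gives \<open>|F\<^sub>n| \<ge> 2\<^bsup>|P|\<^esup>\<close> (\<open>card_var_free_ring_ge\<close>). The points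
  whose first \<open>q\<close> coordinates are a fixed enumeration of \<open>A\<close> are such a set: each remaining
  coordinate of one of them equals one of the first \<open>q\<close>, and which one is visible to a term
  \<open>x\<^sub>i - x\<^sub>j\<close>. There are \<open>q\<^bsup>n-q\<^esup>\<close> of them, a fixed proportion of \<open>A\<^sup>n\<close>. The upper bound
  \<open>log |F\<^sub>n| \<le> q\<^sup>n log q\<close> is trivial.

  If \<open>A\<close> is nonzero and not prime, let \<open>I J = 0\<close> for nonzero ideals \<open>I\<close> and \<open>J\<close>. Either \<open>I \<inter> J = 0\<close>, and then
  a term is determined by its values modulo \<open>I\<close> and modulo \<open>J\<close>. The former only need points that
  avoid a chosen nonzero \<open>a \<in> I\<close>, since \<open>a\<close> may be replaced by \<open>0\<close>; likewise for \<open>J\<close>. Or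
  \<open>K = I \<inter> J\<close> is a nonzero ideal with \<open>K K = 0\<close>; then term functions are affine in directions
  from \<open>K\<close> (\<open>teval_affine\<close>), so a term is determined by the points with at most one coordinate
  equal to a chosen nonzero \<open>a \<in> K\<close>. Both ways at most \<open>(n + 1) (q - 1)\<^sup>n\<close> points suffice, and
  the potential is at most \<open>q - 1\<close>.
\<close>

section \<open>Points and sets of points that determine a term\<close>

text \<open>
  Points of \<open>A\<^sup>n\<close> are represented by assignments on all of \<open>nat\<close> with fixed values outside a finite
  index set, because terms are evaluated at total assignments with values in the carrier. The default
  \<open>d\<close> is \<open>\<zero>\<close> for plain points; the prime case uses it to prescribe initial coordinates.
\<close>

definition variations :: "nat set \<Rightarrow> 'a set \<Rightarrow> (nat \<Rightarrow> 'a) \<Rightarrow> (nat \<Rightarrow> 'a) set" where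
  "variations I T d = {\<rho>. (\<forall>i\<in>I. \<rho> i \<in> T) \<and> (\<forall>i. i \<notin> I \<longrightarrow> \<rho> i = d i)}"

lemma finite_card_variations:
  assumes "finite I" "finite T"
  shows "finite (variations I T d)" and "card (variations I T d) = card T ^ card I"
proof -
  have "bij_betw (\<lambda>\<rho>. restrict \<rho> I) (variations I T d) (I \<rightarrow>\<^sub>E T)"
    by (rule bij_betw_byWitness[where f' = "\<lambda>g i. if i \<in> I then g i else d i"])
      (auto simp: variations_def PiE_def extensional_def fun_eq_iff)
  moreover have "finite (I \<rightarrow>\<^sub>E T)" "card (I \<rightarrow>\<^sub>E T) = card T ^ card I"
    using assms by (auto simp: finite_PiE card_PiE)
  ultimately show "finite (variations I T d)" "card (variations I T d) = card T ^ card I"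
    by (auto dest: bij_betw_finite bij_betw_same_card)
qed

definition determining_set :: "('a, 'm) ring_scheme \<Rightarrow> nat \<Rightarrow> (nat \<Rightarrow> 'a) set \<Rightarrow> bool" where
  "determining_set R n S \<longleftrightarrow> finite S \<and> S \<subseteq> UNIV \<rightarrow> carrier R \<and>
     (\<forall>t\<in>terms_upto n. (\<forall>\<rho>\<in>S. teval R \<rho> t = \<zero>\<^bsub>R\<^esub>) \<longrightarrow> (\<forall>\<rho>\<in>UNIV \<rightarrow> carrier R. teval R \<rho> t = \<zero>\<^bsub>R\<^esub>))"

text \<open>A canonical choice of a term in each class, so that elements of the free ring can be evaluated.\<close>

lemma class_representative:
  assumes "X \<in> carrier (var_free_ring A n)"
  shows "(SOME s. s \<in> X) \<in> terms_upto n" and "X = identity_rel A n `` {SOME s. s \<in> X}"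
proof -
  obtain s where s: "s \<in> terms_upto n" "X = identity_rel A n `` {s}"
    using assms by (rule classE)
  then have "s \<in> X" by (auto simp: identity_rel_def holds_identity_def)
  then have "(SOME s. s \<in> X) \<in> X" by (rule someI)
  then have r: "(s, SOME s. s \<in> X) \<in> identity_rel A n" using s by auto
  then show "(SOME s. s \<in> X) \<in> terms_upto n" by (auto simp: identity_rel_def)
  show "X = identity_rel A n `` {SOME s. s \<in> X}"
    by (rule trans[OF s(2) equiv_class_eq[OF equiv_identity_rel r]])
qed

context nonassoc_ring
begin

lemma teval_mem [simp]: "\<rho> \<in> UNIV \<rightarrow> carrier R \<Longrightarrow> teval R \<rho> t \<in> carrier R"
  by (intro teval_closed) auto

lemma mult_zero_left [simp]: "x \<in> carrier R \<Longrightarrow> \<zero> \<otimes> x = \<zero>"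
  using l_distr[of \<zero> \<zero> x] by simp

lemma mult_zero_right [simp]: "x \<in> carrier R \<Longrightarrow> x \<otimes> \<zero> = \<zero>"
  using r_distr[of \<zero> \<zero> x] by simp

section \<open>Ideals of a nonassociative ring\<close>

lemma nonassoc_idealD:
  assumes "nonassoc_ideal I R"
  shows "I \<subseteq> carrier R" "\<zero> \<in> I" "u \<in> I \<Longrightarrow> v \<in> I \<Longrightarrow> u \<oplus> v \<in> I" "u \<in> I \<Longrightarrow> \<ominus> u \<in> I"
    "u \<in> I \<Longrightarrow> x \<in> carrier R \<Longrightarrow> x \<otimes> u \<in> I" "u \<in> I \<Longrightarrow> x \<in> carrier R \<Longrightarrow> u \<otimes> x \<in> I"
proof -
  interpret additive_subgroup I R using assms by (simp add: nonassoc_ideal_def)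
  show "I \<subseteq> carrier R" "\<zero> \<in> I" "u \<in> I \<Longrightarrow> v \<in> I \<Longrightarrow> u \<oplus> v \<in> I" "u \<in> I \<Longrightarrow> \<ominus> u \<in> I"
    using a_subset a_subgroup by (auto simp: a_inv_closed)
  show "u \<in> I \<Longrightarrow> x \<in> carrier R \<Longrightarrow> x \<otimes> u \<in> I" "u \<in> I \<Longrightarrow> x \<in> carrier R \<Longrightarrow> u \<otimes> x \<in> I"
    using assms by (auto simp: nonassoc_ideal_def)
qed

lemma nonassoc_idealI:
  assumes "I \<subseteq> carrier R" "\<zero> \<in> I" "\<And>u v. u \<in> I \<Longrightarrow> v \<in> I \<Longrightarrow> u \<oplus> v \<in> I"
    "\<And>u. u \<in> I \<Longrightarrow> \<ominus> u \<in> I" "\<And>u x. u \<in> I \<Longrightarrow> x \<in> carrier R \<Longrightarrow> x \<otimes> u \<in> I"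
    "\<And>u x. u \<in> I \<Longrightarrow> x \<in> carrier R \<Longrightarrow> u \<otimes> x \<in> I"
  shows "nonassoc_ideal I R"
proof -
  have "subgroup I (add_monoid R)"
    using assms(1-4) by (auto simp: subgroup_def a_inv_def[symmetric])
  then show ?thesis
    using assms(5,6) by (auto simp: nonassoc_ideal_def additive_subgroup_def)
qed

lemma nonassoc_ideal_Int:
  assumes "nonassoc_ideal I R" "nonassoc_ideal J R"
  shows "nonassoc_ideal (I \<inter> J) R"
  using nonassoc_idealD[OF assms(1)] nonassoc_idealD[OF assms(2)]
  by (intro nonassoc_idealI) auto

section \<open>Upper bounds from determining sets\<close>

text \<open>
  Two terms with the same values on \<open>S\<close> have a difference vanishing on \<open>S\<close>, hence everywhere; so an
  element of the free ring is recorded faithfully by its values on \<open>S\<close>.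
\<close>

lemma card_var_free_ring_le:
  assumes fin: "finite (carrier R)" and S: "determining_set R n S"
  shows "card (carrier (var_free_ring R n)) \<le> card (carrier R) ^ card S"
proof -
  let ?F = "var_free_ring R n"
  define r where "r X = (SOME s. s \<in> X)" for X :: "rterm set"
  define f where "f = (\<lambda>X. restrict (\<lambda>\<rho>. teval R \<rho> (r X)) S)"
  have SC: "\<rho> \<in> UNIV \<rightarrow> carrier R" if "\<rho> \<in> S" for \<rho>
    using S that by (auto simp: determining_set_def)
  have "inj_on f (carrier ?F)"
  proof (rule inj_onI)
    fix X Y assume X: "X \<in> carrier ?F" and Y: "Y \<in> carrier ?F" and eq: "f X = f Y"
    note rX = class_representative[OF X, folded r_def]
    note rY = class_representative[OF Y, folded r_def]
    let ?t = "TAdd (r X) (TNeg (r Y))"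
    have "teval R \<rho> ?t = \<zero>" if "\<rho> \<in> S" for \<rho>
      using fun_cong[OF eq, of \<rho>] that SC[OF that] by (simp add: f_def r_neg)
    moreover have "?t \<in> terms_upto n" using rX(1) rY(1) by simp
    ultimately have van: "teval R \<rho> ?t = \<zero>" if "\<rho> \<in> UNIV \<rightarrow> carrier R" for \<rho>
      using S that unfolding determining_set_def by blast
    have "teval R \<rho> (r X) = teval R \<rho> (r Y)" if "\<rho> \<in> UNIV \<rightarrow> carrier R" for \<rho>
      using van[OF that] that minus_equality[of "teval R \<rho> (r X)" "\<ominus> teval R \<rho> (r Y)"] by simp
    then have "holds_identity R (r X) (r Y)" by (simp add: holds_identity_def)
    then show "X = Y" using rX rY class_eq_iff by metis
  qed
  moreover have "f ` carrier ?F \<subseteq> S \<rightarrow>\<^sub>E carrier R"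
    using SC by (auto simp: f_def)
  moreover have "finite (S \<rightarrow>\<^sub>E carrier R)" "card (S \<rightarrow>\<^sub>E carrier R) = card (carrier R) ^ card S"
    using S fin by (auto simp: determining_set_def finite_PiE card_PiE)
  ultimately show ?thesis by (metis card_inj_on_le)
qed

lemma teval_cong_ideal:
  assumes I: "nonassoc_ideal I R"
    and "\<rho> \<in> UNIV \<rightarrow> carrier R" and "\<And>i. \<exists>u\<in>I. \<sigma> i = \<rho> i \<oplus> u"
  shows "\<exists>u\<in>I. teval R \<sigma> t = teval R \<rho> t \<oplus> u"
proof (induction t)
  case (TVar i)
  then show ?case using assms(3) by simp
next
  case TZero
  then show ?case using nonassoc_idealD(2)[OF I] by (auto intro!: bexI[of _ \<zero>])
next
  case (TNeg t)
  then obtain u where "u \<in> I" "teval R \<sigma> t = teval R \<rho> t \<oplus> u" by blast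
  then show ?case
    using nonassoc_idealD(1,4)[OF I] assms(2) by (intro bexI[of _ "\<ominus> u"]) (auto simp: minus_add)
next
  case (TAdd s t)
  then obtain u v where "u \<in> I" "v \<in> I"
    "teval R \<sigma> s = teval R \<rho> s \<oplus> u" "teval R \<sigma> t = teval R \<rho> t \<oplus> v" by blast
  moreover from this have "u \<in> carrier R" "v \<in> carrier R" using nonassoc_idealD(1)[OF I] by auto
  ultimately show ?case
    using nonassoc_idealD(3)[OF I] assms(2) by (intro bexI[of _ "u \<oplus> v"]) (auto simp: a_ac)
next
  case (TMult s t)
  then obtain u v where uv: "u \<in> I" "v \<in> I"
    "teval R \<sigma> s = teval R \<rho> s \<oplus> u" "teval R \<sigma> t = teval R \<rho> t \<oplus> v" by blast
  moreover from uv have "u \<in> carrier R" "v \<in> carrier R" using nonassoc_idealD(1)[OF I] by auto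
  ultimately show ?case
    using nonassoc_idealD(3,5,6)[OF I] assms(2)
    by (intro bexI[of _ "teval R \<rho> s \<otimes> v \<oplus> (u \<otimes> teval R \<rho> t \<oplus> u \<otimes> v)"])
      (auto simp: l_distr r_distr a_ac)
qed

text \<open>
  If \<open>K K = 0\<close>, all products of two increments from \<open>K\<close> drop out of a term, so the increment of the
  term is additive in the increment of the assignment. The assignments \<open>\<rho>\<close>, \<open>\<alpha>\<close>, \<open>\<beta>\<close>,
  \<open>\<gamma>\<close> are the corners of a parallelogram with sides in \<open>K\<close>, and so are the values of the term.
\<close>

lemma teval_affine:
  assumes K: "nonassoc_ideal K R" and sq: "\<And>u v. u \<in> K \<Longrightarrow> v \<in> K \<Longrightarrow> u \<otimes> v = \<zero>"
    and \<rho>: "\<rho> \<in> UNIV \<rightarrow> carrier R"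
    and "\<And>i. \<exists>u\<in>K. \<exists>v\<in>K. \<alpha> i = \<rho> i \<oplus> u \<and> \<beta> i = \<rho> i \<oplus> v \<and> \<gamma> i = \<rho> i \<oplus> (u \<oplus> v)"
  shows "\<exists>u\<in>K. \<exists>v\<in>K. teval R \<alpha> t = teval R \<rho> t \<oplus> u \<and> teval R \<beta> t = teval R \<rho> t \<oplus> v \<and>
    teval R \<gamma> t = teval R \<rho> t \<oplus> (u \<oplus> v)"
proof (induction t)
  case (TVar i)
  then show ?case using assms(4) by simp
next
  case TZero
  then show ?case using nonassoc_idealD(2)[OF K] by (auto intro!: bexI[of _ \<zero>])
next
  case (TNeg t)
  then obtain u v where "u \<in> K" "v \<in> K" "teval R \<alpha> t = teval R \<rho> t \<oplus> u"
    "teval R \<beta> t = teval R \<rho> t \<oplus> v" "teval R \<gamma> t = teval R \<rho> t \<oplus> (u \<oplus> v)" by blast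
  moreover from this have "u \<in> carrier R" "v \<in> carrier R" using nonassoc_idealD(1)[OF K] by auto
  ultimately show ?case
    using nonassoc_idealD(4)[OF K] \<rho>
    by (intro bexI[of _ "\<ominus> u"] bexI[of _ "\<ominus> v"]) (auto simp: minus_add)
next
  case (TAdd s t)
  then obtain u v where 1: "u \<in> K" "v \<in> K" "teval R \<alpha> s = teval R \<rho> s \<oplus> u"
    "teval R \<beta> s = teval R \<rho> s \<oplus> v" "teval R \<gamma> s = teval R \<rho> s \<oplus> (u \<oplus> v)" by blast
  from TAdd obtain u' v' where 2: "u' \<in> K" "v' \<in> K" "teval R \<alpha> t = teval R \<rho> t \<oplus> u'"
    "teval R \<beta> t = teval R \<rho> t \<oplus> v'" "teval R \<gamma> t = teval R \<rho> t \<oplus> (u' \<oplus> v')" by blast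
  from 1 2 have "u \<in> carrier R" "v \<in> carrier R" "u' \<in> carrier R" "v' \<in> carrier R"
    using nonassoc_idealD(1)[OF K] by auto
  then show ?case
    using 1 2 nonassoc_idealD(3)[OF K] \<rho>
    by (intro bexI[of _ "u \<oplus> u'"] bexI[of _ "v \<oplus> v'"]) (auto simp: a_ac)
next
  case (TMult s t)
  then obtain u v where 1: "u \<in> K" "v \<in> K" "teval R \<alpha> s = teval R \<rho> s \<oplus> u"
    "teval R \<beta> s = teval R \<rho> s \<oplus> v" "teval R \<gamma> s = teval R \<rho> s \<oplus> (u \<oplus> v)" by blast
  from TMult obtain u' v' where 2: "u' \<in> K" "v' \<in> K" "teval R \<alpha> t = teval R \<rho> t \<oplus> u'"
    "teval R \<beta> t = teval R \<rho> t \<oplus> v'" "teval R \<gamma> t = teval R \<rho> t \<oplus> (u' \<oplus> v')" by blast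
  from 1 2 have c: "u \<in> carrier R" "v \<in> carrier R" "u' \<in> carrier R" "v' \<in> carrier R"
    using nonassoc_idealD(1)[OF K] by auto
  \<comment> \<open>The product rule: the increment of a product when the factors move by \<open>w\<close> and \<open>w'\<close>.\<close>
  let ?D = "\<lambda>w w'. teval R \<rho> s \<otimes> w' \<oplus> w \<otimes> teval R \<rho> t"
  have D: "?D w w' \<in> K" "(teval R \<rho> s \<oplus> w) \<otimes> (teval R \<rho> t \<oplus> w') =
      teval R \<rho> s \<otimes> teval R \<rho> t \<oplus> ?D w w'" if "w \<in> K" "w' \<in> K" for w w'
  proof -
    have "w \<in> carrier R" "w' \<in> carrier R" using that nonassoc_idealD(1)[OF K] by auto
    then show "?D w w' \<in> K" "(teval R \<rho> s \<oplus> w) \<otimes> (teval R \<rho> t \<oplus> w') =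
      teval R \<rho> s \<otimes> teval R \<rho> t \<oplus> ?D w w'"
      using that nonassoc_idealD(3,5,6)[OF K] \<rho> sq[OF that] by (auto simp: l_distr r_distr a_ac)
  qed
  have "?D (u \<oplus> v) (u' \<oplus> v') = ?D u u' \<oplus> ?D v v'"
    using c \<rho> by (simp add: l_distr r_distr a_ac)
  then show ?case
    using 1 2 D nonassoc_idealD(3)[OF K]
    by (intro bexI[of _ "?D u u'"] bexI[of _ "?D v v'"]) auto
qed

lemma determining_setI:
  assumes "finite S" "S \<subseteq> UNIV \<rightarrow> carrier R"
    and "\<And>t \<sigma>. \<lbrakk>\<forall>\<rho>\<in>S. teval R \<rho> t = \<zero>; \<sigma> \<in> variations {..<n} (carrier R) (\<lambda>_. \<zero>)\<rbrakk> \<Longrightarrow>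
      teval R \<sigma> t = \<zero>"
  shows "determining_set R n S"
  unfolding determining_set_def
proof (intro conjI ballI impI assms(1,2))
  fix t and \<rho> :: "nat \<Rightarrow> 'a"
  assume t: "t \<in> terms_upto n" "\<forall>\<rho>\<in>S. teval R \<rho> t = \<zero>" and \<rho>: "\<rho> \<in> UNIV \<rightarrow> carrier R"
  have "teval R \<rho> t = teval R (\<lambda>i. if i < n then \<rho> i else \<zero>) t"
    using t(1) by (intro teval_cong) (auto simp: terms_upto_def)
  also have "\<dots> = \<zero>"
    using \<rho> by (intro assms(3)[OF t(2)]) (auto simp: variations_def Pi_iff)
  finally show "teval R \<rho> t = \<zero>" .
qed

text \<open>Replacing every coordinate \<open>a\<close> by \<open>\<zero>\<close> moves the point by elements of \<open>I\<close> only.\<close>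

lemma teval_in_ideal:
  assumes I: "nonassoc_ideal I R" and a: "a \<in> I" "a \<noteq> \<zero>"
    and van: "\<forall>\<rho>\<in>variations {..<n} (carrier R - {a}) (\<lambda>_. \<zero>). teval R \<rho> t = \<zero>"
    and \<sigma>: "\<sigma> \<in> variations {..<n} (carrier R) (\<lambda>_. \<zero>)"
  shows "teval R \<sigma> t \<in> I"
proof -
  let ?\<rho> = "\<lambda>i. if \<sigma> i = a then \<zero> else \<sigma> i"
  have \<sigma>': "\<sigma> i \<in> carrier R" for i using \<sigma> by (cases "i < n") (auto simp: variations_def)
  have "\<exists>u\<in>I. teval R \<sigma> t = teval R ?\<rho> t \<oplus> u"
  proof (rule teval_cong_ideal[OF I])
    show "\<exists>u\<in>I. \<sigma> i = ?\<rho> i \<oplus> u" for i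
      using \<sigma>' a nonassoc_idealD(1,2)[OF I]
      by (intro bexI[of _ "if \<sigma> i = a then a else \<zero>"]) auto
  qed (use \<sigma>' in auto)
  moreover have "teval R ?\<rho> t = \<zero>"
    using van \<sigma> a by (auto simp: variations_def)
  ultimately show ?thesis using nonassoc_idealD(1)[OF I] by auto
qed

lemma determining_set_disjoint_ideals:
  assumes fin: "finite (carrier R)"
    and I: "nonassoc_ideal I R" "a \<in> I" "a \<noteq> \<zero>" and J: "nonassoc_ideal J R" "b \<in> J" "b \<noteq> \<zero>"
    and disj: "I \<inter> J = {\<zero>}"
  shows "\<exists>S. determining_set R n S \<and> card S \<le> 2 * (card (carrier R) - 1) ^ n"
proof -
  let ?V = "\<lambda>c. variations {..<n} (carrier R - {c}) (\<lambda>_. \<zero>)"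
  have c: "finite (?V c) \<and> card (?V c) = (card (carrier R) - 1) ^ n" if "c \<in> carrier R" for c
    using finite_card_variations[of "{..<n}" "carrier R - {c}"] fin that by (simp)
  have ab: "a \<in> carrier R" "b \<in> carrier R" using I J nonassoc_idealD(1) by auto
  have "determining_set R n (?V a \<union> ?V b)"
  proof (rule determining_setI)
    show "?V a \<union> ?V b \<subseteq> UNIV \<rightarrow> carrier R"
      by (auto simp: variations_def)
    fix t \<sigma> assume "\<forall>\<rho>\<in>?V a \<union> ?V b. teval R \<rho> t = \<zero>"
      and "\<sigma> \<in> variations {..<n} (carrier R) (\<lambda>_. \<zero>)"
    then have "teval R \<sigma> t \<in> I \<inter> J"
      using teval_in_ideal[OF I] teval_in_ideal[OF J] by blast
    then show "teval R \<sigma> t = \<zero>" using disj by auto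
  qed (use c ab in auto)
  moreover have "card (?V a \<union> ?V b) \<le> 2 * (card (carrier R) - 1) ^ n"
    using card_Un_le[of "?V a" "?V b"] c ab by simp
  ultimately show ?thesis by blast
qed

text \<open>
  A point with at least two coordinates equal to \<open>a\<close> is a corner of a parallelogram whose other
  corners have one or both of these coordinates replaced by \<open>\<zero>\<close>. By \<open>teval_affine\<close>, a term that
  vanishes at the other three corners vanishes there, so induction on the number of
  coordinates equal to \<open>a\<close> reduces everything to the points with at most one such coordinate.
\<close>

lemma determining_set_square_zero:
  assumes fin: "finite (carrier R)"
    and K: "nonassoc_ideal K R" "a \<in> K" "a \<noteq> \<zero>"
    and sq: "\<And>u v. u \<in> K \<Longrightarrow> v \<in> K \<Longrightarrow> u \<otimes> v = \<zero>"
  shows "\<exists>S. determining_set R n S \<and> card S \<le> (n + 1) * (card (carrier R) - 1) ^ n"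
proof -
  let ?V = "variations {..<n} (carrier R - {a}) (\<lambda>_. \<zero>)"
  \<comment> \<open>\<open>?V\<close> holds the points without a coordinate \<open>a\<close>; those with exactly one all lie in \<open>?W\<close>.\<close>
  let ?W = "(\<lambda>(\<rho>, i). \<rho>(i := a)) ` (?V \<times> {..<n})"
  have aR: "a \<in> carrier R" using K nonassoc_idealD(1) by auto
  have c: "finite ?V" "card ?V = (card (carrier R) - 1) ^ n"
    using finite_card_variations[of "{..<n}" "carrier R - {a}"] fin aR by simp_all
  have "determining_set R n (?V \<union> ?W)"
  proof (rule determining_setI)
    show "?V \<union> ?W \<subseteq> UNIV \<rightarrow> carrier R"
      using aR by (auto simp: variations_def) (metis DiffD1 lessThan_iff zero_closed)+
    fix t \<sigma> assume van: "\<forall>\<rho>\<in>?V \<union> ?W. teval R \<rho> t = \<zero>"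
      and \<sigma>: "\<sigma> \<in> variations {..<n} (carrier R) (\<lambda>_. \<zero>)"
    show "teval R \<sigma> t = \<zero>"
      using \<sigma>
    proof (induction "card {i\<in>{..<n}. \<sigma> i = a}" arbitrary: \<sigma> rule: less_induct)
      case less
      note \<sigma> = less.prems
      let ?N = "\<lambda>\<sigma>. {i\<in>{..<n}. \<sigma> i = a}"
      show ?case
      proof (cases "?N \<sigma> = {}")
        case True
        then have "\<sigma> \<in> ?V" using \<sigma> by (auto simp: variations_def)
        then show ?thesis using van by blast
      next
        case False
        then obtain i where i: "i < n" "\<sigma> i = a" by auto
        let ?\<alpha> = "\<sigma>(i := \<zero>)"
        show ?thesis
        proof (cases "?N ?\<alpha> = {}")
          case True
          then have "?\<alpha> \<in> ?V" using \<sigma> K(3) by (auto simp: variations_def)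
          moreover have "\<sigma> = (\<lambda>(\<rho>, i). \<rho>(i := a)) (?\<alpha>, i)" using i by auto
          ultimately have "\<sigma> \<in> ?W" using i(1) by blast
          then show ?thesis using van by blast
        next
          case False
          then obtain j where j: "j < n" "\<sigma> j = a" "j \<noteq> i" using K(3) by (auto split: if_splits)
          let ?\<beta> = "\<sigma>(j := \<zero>)"
          let ?\<rho> = "\<sigma>(i := \<zero>, j := \<zero>)"
          have \<sigma>': "\<sigma> k \<in> carrier R" for k using \<sigma> by (cases "k < n") (auto simp: variations_def)
          have van': "teval R \<tau> t = \<zero>"
            if "?N \<tau> \<subset> ?N \<sigma>" "\<tau> \<in> variations {..<n} (carrier R) (\<lambda>_. \<zero>)" for \<tau>
            using that by (intro less.hyps psubset_card_mono) auto
          have z: "teval R ?\<alpha> t = \<zero>" "teval R ?\<beta> t = \<zero>" "teval R ?\<rho> t = \<zero>"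
            using \<sigma> i j K(3) by (intro van'; auto simp: variations_def)+
          have "\<exists>u\<in>K. \<exists>v\<in>K. teval R ?\<alpha> t = teval R ?\<rho> t \<oplus> u \<and> teval R ?\<beta> t = teval R ?\<rho> t \<oplus> v \<and>
            teval R \<sigma> t = teval R ?\<rho> t \<oplus> (u \<oplus> v)"
          proof (rule teval_affine[OF K(1) sq])
            fix k
            show "\<exists>u\<in>K. \<exists>v\<in>K. ?\<alpha> k = ?\<rho> k \<oplus> u \<and> ?\<beta> k = ?\<rho> k \<oplus> v \<and> \<sigma> k = ?\<rho> k \<oplus> (u \<oplus> v)"
              using i j aR \<sigma>' nonassoc_idealD(2)[OF K(1)] K(2)
              by (intro bexI[of _ "if k = j then a else \<zero>"] bexI[of _ "if k = i then a else \<zero>"]) auto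
          qed (use \<sigma>' in auto)
          then show ?thesis using z nonassoc_idealD(1)[OF K(1)] by auto
        qed
      qed
    qed
  qed (use c in auto)
  moreover have "card (?V \<union> ?W) \<le> (n + 1) * (card (carrier R) - 1) ^ n"
  proof -
    have "card ?W \<le> card (?V \<times> {..<n})" using c by (intro card_image_le) auto
    also have "\<dots> = (card (carrier R) - 1) ^ n * n" using c by (simp add: card_cartesian_product)
    finally show ?thesis using card_Un_le[of ?V ?W] c by (simp add: algebra_simps)
  qed
  ultimately show ?thesis by blast
qed

text \<open>
  For the zero ring the bound is \<open>0\<close> and the empty set determines every term. Otherwise
  \<open>I J = 0\<close> implies that \<open>I \<inter> J\<close> has square zero, which leaves the two preceding cases.
\<close>

lemma not_prime_determining_set:
  assumes fin: "finite (carrier R)" and np: "\<not> nonassoc_prime R" and n: "n \<ge> 1"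
  shows "\<exists>S. determining_set R n S \<and> card S \<le> (n + 1) * (card (carrier R) - 1) ^ n"
proof (cases "carrier R = {\<zero>}")
  case True
  then have "determining_set R n {}"
    using teval_mem by (auto simp: determining_set_def)
  then show ?thesis by force
next
  case False
  have "nonassoc_ring R" by unfold_locales
  then obtain I J where I: "nonassoc_ideal I R" "I \<noteq> {\<zero>}" and J: "nonassoc_ideal J R" "J \<noteq> {\<zero>}"
    and IJ: "\<And>u v. u \<in> I \<Longrightarrow> v \<in> J \<Longrightarrow> u \<otimes> v = \<zero>"
    using np False unfolding nonassoc_prime_def by blast
  show ?thesis
  proof (cases "I \<inter> J = {\<zero>}")
    case True
    obtain a b where "a \<in> I" "a \<noteq> \<zero>" "b \<in> J" "b \<noteq> \<zero>"
      using I J nonassoc_idealD(2) by blast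
    then obtain S where "determining_set R n S" "card S \<le> 2 * (card (carrier R) - 1) ^ n"
      using determining_set_disjoint_ideals[OF fin I(1) _ _ J(1) _ _ True] by blast
    moreover have "2 * (card (carrier R) - 1) ^ n \<le> (n + 1) * (card (carrier R) - 1) ^ n"
      using n by (intro mult_right_mono) auto
    ultimately show ?thesis using le_trans by blast
  next
    case False
    then obtain a where "a \<in> I \<inter> J" "a \<noteq> \<zero>"
      using nonassoc_idealD(2)[OF I(1)] nonassoc_idealD(2)[OF J(1)] by blast
    then show ?thesis
      using IJ by (intro determining_set_square_zero[OF fin nonassoc_ideal_Int[OF I(1) J(1)]]) auto
  qed
qed

section \<open>Lower bounds by interpolation\<close>

text \<open>
  Terms vanishing on \<open>Q\<close> are closed under multiplication by any variable. The hypothesis that the first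
  \<open>n\<close> coordinates of \<open>p\<close> exhaust the ring turns this into closure of their values at \<open>p\<close> under
  multiplication by any element.
\<close>

lemma values_of_vanishing_terms_ideal:
  assumes Q: "Q \<subseteq> UNIV \<rightarrow> carrier R" and p: "p \<in> UNIV \<rightarrow> carrier R" "carrier R \<subseteq> p ` {..<n}"
  shows "nonassoc_ideal (teval R p ` {t\<in>terms_upto n. \<forall>\<rho>\<in>Q. teval R \<rho> t = \<zero>}) R"
    (is "nonassoc_ideal (_ ` ?T) R")
proof (rule nonassoc_idealI)
  have var: "\<exists>i<n. x = teval R p (TVar i)" if "x \<in> carrier R" for x using p that by auto
  have Qi: "\<rho> i \<in> carrier R" if "\<rho> \<in> Q" for \<rho> i using Q that by auto
  show "teval R p ` ?T \<subseteq> carrier R" using p by auto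
  show "\<zero> \<in> teval R p ` ?T" by (rule image_eqI[of _ _ TZero]) auto
  fix u assume "u \<in> teval R p ` ?T"
  then obtain s where s: "s \<in> ?T" "u = teval R p s" by auto
  show "\<ominus> u \<in> teval R p ` ?T" by (rule image_eqI[of _ _ "TNeg s"]) (use s in auto)
  show "u \<oplus> v \<in> teval R p ` ?T" if "v \<in> teval R p ` ?T" for v
  proof -
    obtain t where "t \<in> ?T" "v = teval R p t" using \<open>v \<in> _\<close> by auto
    then show ?thesis by (intro image_eqI[of _ _ "TAdd s t"]) (use s in auto)
  qed
  fix x assume "x \<in> carrier R"
  then obtain i where i: "i < n" "x = teval R p (TVar i)" using var by blast
  show "x \<otimes> u \<in> teval R p ` ?T"
    by (rule image_eqI[of _ _ "TMult (TVar i) s"]) (use s i Qi in auto)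
  show "u \<otimes> x \<in> teval R p ` ?T"
    by (rule image_eqI[of _ _ "TMult s (TVar i)"]) (use s i Qi in auto)
qed

text \<open>
  Prime avoidance in terms of points: if the values at \<open>p\<close> of the terms vanishing on \<open>Q\<close> and of the
  terms vanishing at \<open>q\<close> are both nonzero ideals, primeness yields a nonzero product, and the
  corresponding product of terms vanishes on \<open>insert q Q\<close> but not at \<open>p\<close>.
\<close>

lemma prime_isolating_term:
  assumes prime: "nonassoc_prime R" and p: "p \<in> UNIV \<rightarrow> carrier R" "carrier R \<subseteq> p ` {..<n}"
    and "finite Q" "Q \<subseteq> UNIV \<rightarrow> carrier R"
    and sep: "\<And>\<rho>. \<rho> \<in> Q \<Longrightarrow> \<exists>t\<in>terms_upto n. teval R \<rho> t = \<zero> \<and> teval R p t \<noteq> \<zero>"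
  shows "\<exists>t\<in>terms_upto n. (\<forall>\<rho>\<in>Q. teval R \<rho> t = \<zero>) \<and> teval R p t \<noteq> \<zero>"
  using assms(4-)
proof (induction Q)
  case empty
  obtain x where "x \<in> carrier R" "x \<noteq> \<zero>"
    using prime zero_closed unfolding nonassoc_prime_def by blast
  then obtain i where "i < n" "p i \<noteq> \<zero>" using p by auto
  then show ?case by (intro bexI[of _ "TVar i"]) auto
next
  case (insert q Q)
  let ?I = "\<lambda>Q. teval R p ` {t\<in>terms_upto n. \<forall>\<rho>\<in>Q. teval R \<rho> t = \<zero>}"
  have ideals: "nonassoc_ideal (?I Q) R" "nonassoc_ideal (?I {q}) R"
    using insert.prems by (intro values_of_vanishing_terms_ideal p; auto)+
  obtain s where "s \<in> terms_upto n" "\<forall>\<rho>\<in>Q. teval R \<rho> s = \<zero>" "teval R p s \<noteq> \<zero>"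
    using insert.IH insert.prems by (metis insert_subset insertCI)
  then have "teval R p s \<in> ?I Q" "teval R p s \<noteq> \<zero>" by auto
  then have 1: "?I Q \<noteq> {\<zero>}" by blast
  obtain t where "t \<in> terms_upto n" "teval R q t = \<zero>" "teval R p t \<noteq> \<zero>"
    using insert.prems(2) by blast
  then have "teval R p t \<in> ?I {q}" "teval R p t \<noteq> \<zero>" by auto
  then have 2: "?I {q} \<noteq> {\<zero>}" by blast
  obtain a b where ab: "a \<in> ?I Q" "b \<in> ?I {q}" "a \<otimes> b \<noteq> \<zero>"
    using prime ideals 1 2 unfolding nonassoc_prime_def by meson
  then obtain u v where "u \<in> terms_upto n" "v \<in> terms_upto n" "\<forall>\<rho>\<in>Q. teval R \<rho> u = \<zero>"
    "teval R q v = \<zero>" "a = teval R p u" "b = teval R p v" by auto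
  then show ?case
    using ab(3) insert.prems(1) by (intro bexI[of _ "TMult u v"]) auto
qed

text \<open>
  Adding up isolating terms realises every subset of \<open>P\<close> as the set of points of \<open>P\<close> where some term
  does not vanish, and this set depends only on the class of the term.
\<close>

lemma card_var_free_ring_ge:
  assumes fin: "finite (carrier R)" and "finite P" "P \<subseteq> UNIV \<rightarrow> carrier R"
    and iso: "\<And>p. p \<in> P \<Longrightarrow> \<exists>t\<in>terms_upto n. (\<forall>\<rho>\<in>P - {p}. teval R \<rho> t = \<zero>) \<and> teval R p t \<noteq> \<zero>"
  shows "2 ^ card P \<le> card (carrier (var_free_ring R n))"
proof -
  let ?F = "var_free_ring R n"
  let ?supp = "\<lambda>t. {\<rho>\<in>P. teval R \<rho> t \<noteq> \<zero>}"
  have PC: "\<rho> \<in> UNIV \<rightarrow> carrier R" if "\<rho> \<in> P" for \<rho> using assms(3) that by auto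
  have supp: "\<exists>t\<in>terms_upto n. ?supp t = U" if "finite U" "U \<subseteq> P" for U
    using that
  proof (induction U)
    case empty
    then show ?case by (intro bexI[of _ TZero]) auto
  next
    case (insert p U)
    then obtain s where s: "s \<in> terms_upto n" "?supp s = U" by auto
    obtain t where t: "t \<in> terms_upto n" "\<forall>\<rho>\<in>P - {p}. teval R \<rho> t = \<zero>" "teval R p t \<noteq> \<zero>"
      using iso[of p] insert.prems by blast
    have "teval R \<rho> (TAdd s t) \<noteq> \<zero> \<longleftrightarrow> \<rho> = p \<or> \<rho> \<in> U" if "\<rho> \<in> P" for \<rho>
    proof (cases "\<rho> = p")
      case True
      then have "teval R \<rho> s = \<zero>" using s(2) insert.hyps insert.prems by blast
      then show ?thesis using True t(3) PC[OF that] by simp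
    next
      case False
      then show ?thesis using t(2) that PC[OF that] s(2) by auto
    qed
    then have "?supp (TAdd s t) = insert p U" using insert.prems by blast
    then show ?case using s(1) t(1) by (intro bexI[of _ "TAdd s t"]) auto
  qed
  have "Pow P \<subseteq> (\<lambda>X. ?supp (SOME t. t \<in> X)) ` carrier ?F"
  proof
    fix U assume "U \<in> Pow P"
    then obtain t where t: "t \<in> terms_upto n" "?supp t = U"
      using supp assms(2) finite_subset by blast
    let ?X = "identity_rel R n `` {t}"
    have X: "?X \<in> carrier ?F" using t(1) by (rule class_closed)
    have "holds_identity R t (SOME t. t \<in> ?X)"
      using class_representative[OF X] t(1) class_eq_iff by blast
    then have "?supp (SOME t. t \<in> ?X) = ?supp t"
      using PC by (auto simp: holds_identity_def)
    then show "U \<in> (\<lambda>X. ?supp (SOME t. t \<in> X)) ` carrier ?F" using t(2) X by blast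
  qed
  moreover have "finite (carrier ?F)"
    by (rule var_free_ring_finite(1)[OF _ fin]) unfold_locales
  ultimately have "card (Pow P) \<le> card (carrier ?F)" by (rule surj_card_le[rotated])
  then show ?thesis using assms(2) by (simp add: card_Pow)
qed

text \<open>
  The points used all begin with the same enumeration \<open>e\<close> of the ring. Hence their coordinates exhaust
  the ring, and two of them that differ in coordinate \<open>i\<close> are separated by \<open>x\<^sub>i - x\<^sub>j\<close>, where
  \<open>j\<close> is the position in the enumeration of the \<open>i\<close>-th coordinate of one of them.
\<close>

lemma prime_card_var_free_ring_ge:
  assumes fin: "finite (carrier R)" and prime: "nonassoc_prime R" and n: "n \<ge> card (carrier R)"
  shows "2 ^ (card (carrier R) ^ (n - card (carrier R))) \<le> card (carrier (var_free_ring R n))"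
proof -
  let ?q = "card (carrier R)"
  obtain e where e: "bij_betw e {..<?q} (carrier R)"
    using ex_bij_betw_nat_finite[OF fin] atLeast0LessThan by auto
  define P where "P = variations {?q..<n} (carrier R) (\<lambda>i. if i < ?q then e i else \<zero>)"
  have P: "finite P" "card P = ?q ^ (n - ?q)"
    using finite_card_variations[of "{?q..<n}" "carrier R"] fin by (simp_all add: P_def)
  have low: "p i = e i" if "p \<in> P" "i < ?q" for p i using that by (simp add: P_def variations_def)
  have PC: "p i \<in> carrier R" if "p \<in> P" for p i
    using that bij_betwE[OF e] by (cases "i < ?q"; cases "i < n") (auto simp: P_def variations_def)
  have gen: "carrier R \<subseteq> p ` {..<n}" if "p \<in> P" for p
  proof -
    have "carrier R = p ` {..<?q}" using e low[OF that] by (auto simp: bij_betw_def)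
    also have "\<dots> \<subseteq> p ` {..<n}" using n by (intro image_mono) auto
    finally show ?thesis .
  qed
  have sep: "\<exists>t\<in>terms_upto n. teval R \<rho> t = \<zero> \<and> teval R p t \<noteq> \<zero>"
    if pq: "p \<in> P" "\<rho> \<in> P" "\<rho> \<noteq> p" for p \<rho>
  proof -
    obtain i where i: "\<rho> i \<noteq> p i" using \<open>\<rho> \<noteq> p\<close> by blast
    have "i < n" using i pq(1,2) n by (cases "i < n") (auto simp: P_def variations_def)
    obtain j where j: "j < ?q" "\<rho> i = e j" using e PC[OF pq(2), of i] by (auto simp: bij_betw_def)
    let ?t = "TAdd (TVar i) (TNeg (TVar j))"
    have "teval R \<rho> ?t = \<zero>" using j low[OF pq(2) j(1)] PC[OF pq(2), of i] by (simp add: r_neg)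
    moreover have "teval R p ?t \<noteq> \<zero>"
    proof
      assume "teval R p ?t = \<zero>"
      then have "p i = p j"
        using minus_equality[of "p i" "\<ominus> p j"] PC[OF pq(1)] by simp
      then show False using i j low[OF pq(1) j(1)] by simp
    qed
    ultimately show ?thesis using \<open>i < n\<close> j(1) n by (intro bexI[of _ ?t]) auto
  qed
  have "\<exists>t\<in>terms_upto n. (\<forall>\<rho>\<in>P - {p}. teval R \<rho> t = \<zero>) \<and> teval R p t \<noteq> \<zero>" if "p \<in> P" for p
    using that PC P(1) by (intro prime_isolating_term[OF prime] gen sep) auto
  then have "2 ^ card P \<le> card (carrier (var_free_ring R n))"
    using P(1) PC by (intro card_var_free_ring_ge fin) auto
  then show ?thesis using P(2) by simp
qed

lemma nontrivial_card_var_free_ring_ge_2: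
  assumes fin: "finite (carrier R)" and "carrier R \<noteq> {\<zero>}" and n: "n \<ge> 1"
  shows "2 \<le> card (carrier (var_free_ring R n))"
proof -
  obtain x where x: "x \<in> carrier R" "x \<noteq> \<zero>" using assms(2) zero_closed by blast
  have "\<exists>t\<in>terms_upto n. teval R (\<lambda>_. x) t \<noteq> \<zero>"
    using x(2) n by (intro bexI[of _ "TVar 0"]) auto
  then show ?thesis using card_var_free_ring_ge[OF fin, of "{\<lambda>_. x}"] x(1) by auto
qed

section \<open>Growth of the free rings and the potential\<close>

lemma card_var_free_ring_pos:
  assumes "finite (carrier R)"
  shows "0 < card (carrier (var_free_ring R n))"
  using card_var_free_ring_ge[OF assms, of "{}" n] by simp

lemma ln_card_var_free_ring_le:
  assumes "finite (carrier R)" "determining_set R n S"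
  shows "ln (real (card (carrier (var_free_ring R n)))) \<le> real (card S) * ln (real (card (carrier R)))"
proof -
  have "card (carrier R) > 0" using assms(1) zero_closed by (auto simp: card_gt_0_iff)
  have "real (card (carrier (var_free_ring R n))) \<le> real (card (carrier R)) ^ card S"
    using card_var_free_ring_le[OF assms] by (metis of_nat_le_iff of_nat_power)
  then have "ln (real (card (carrier (var_free_ring R n)))) \<le> ln (real (card (carrier R)) ^ card S)"
    using card_var_free_ring_pos[OF assms(1)] by (intro ln_mono) auto
  also have "\<dots> = real (card S) * ln (real (card (carrier R)))"
    using \<open>card (carrier R) > 0\<close> by (simp add: ln_realpow)
  finally show ?thesis .
qed

lemma determining_set_all:
  assumes "finite (carrier R)"
  shows "\<exists>S. determining_set R n S \<and> card S = card (carrier R) ^ n"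
proof -
  let ?V = "variations {..<n} (carrier R) (\<lambda>_. \<zero>)"
  have "determining_set R n ?V"
  proof (rule determining_setI)
    show "?V \<subseteq> UNIV \<rightarrow> carrier R"
      by (auto simp: variations_def)
  qed (use finite_card_variations[of "{..<n}"] assms in auto)
  then show ?thesis using finite_card_variations(2)[of "{..<n}" "carrier R"] assms by auto
qed

lemma ln_card_var_free_ring_upper:
  assumes fin: "finite (carrier R)"
  shows "ln (real (card (carrier (var_free_ring R n)))) <
    (ln (real (card (carrier R))) + 1) * real (card (carrier R)) ^ n"
proof -
  have "card (carrier R) > 0" using fin zero_closed by (auto simp: card_gt_0_iff)
  then have "real (card (carrier R)) ^ n > 0" by simp
  moreover obtain S where "determining_set R n S" "card S = card (carrier R) ^ n"
    using determining_set_all[OF fin] by blast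
  then have "ln (real (card (carrier (var_free_ring R n)))) \<le>
      ln (real (card (carrier R))) * real (card (carrier R)) ^ n"
    using ln_card_var_free_ring_le[OF fin, of n S] by (simp add: mult.commute)
  ultimately show ?thesis
    by (simp only: distrib_right mult_1_left)
qed

text \<open>
  For \<open>n \<ge> q\<close> this is half of the bound \<open>q\<^bsup>n-q\<^esup> ln 2\<close> from the interpolation points. The same
  constant serves for \<open>n < q\<close>, where \<open>q\<^sup>n \<le> q\<^sup>q\<close> and \<open>|F\<^sub>n| \<ge> 2\<close> is enough; the
  factor \<open>1/2\<close> makes the inequality strict.
\<close>

lemma prime_ln_card_var_free_ring_lower:
  assumes fin: "finite (carrier R)" and prime: "nonassoc_prime R" and n: "n \<ge> 1"
  shows "ln 2 / (2 * real (card (carrier R)) ^ card (carrier R)) * real (card (carrier R)) ^ n <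
    ln (real (card (carrier (var_free_ring R n))))"
proof -
  let ?q = "card (carrier R)" and ?f = "card (carrier (var_free_ring R n))"
  have q: "?q > 0" using fin zero_closed by (auto simp: card_gt_0_iff)
  have ln: "real m * ln 2 \<le> ln (real ?f)" if "2 ^ m \<le> ?f" for m
  proof -
    have "(2::real) ^ m \<le> real ?f" using that by (metis of_nat_le_iff of_nat_numeral of_nat_power)
    then have "ln ((2::real) ^ m) \<le> ln (real ?f)" by (intro ln_mono) auto
    then show ?thesis by (simp add: ln_realpow)
  qed
  \<comment> \<open>\<open>m\<close> is the number of interpolation points: \<open>q\<^bsup>n-q\<^esup>\<close>, or \<open>1\<close> when \<open>n < q\<close>.\<close>
  obtain m where m: "real m * ln 2 \<le> ln (real ?f)" "real ?q ^ n \<le> real m * real ?q ^ ?q" "m > 0"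
  proof (cases "n \<ge> ?q")
    case True
    then have "real ?q ^ n = real (?q ^ (n - ?q)) * real ?q ^ ?q"
      by (simp flip: power_add)
    then show ?thesis
      using that[OF ln[OF prime_card_var_free_ring_ge[OF fin prime True]]] q by simp
  next
    case False
    have "carrier R \<noteq> {\<zero>}" using prime by (simp add: nonassoc_prime_def)
    from nontrivial_card_var_free_ring_ge_2[OF fin this n]
    have "2 ^ 1 \<le> ?f" by simp
    moreover have "real ?q ^ n \<le> real 1 * real ?q ^ ?q"
      using False q by (simp add: power_increasing)
    ultimately show ?thesis by (rule that[OF ln _ zero_less_one])
  qed
  have "ln 2 / (2 * real ?q ^ ?q) * real ?q ^ n \<le> ln 2 / (2 * real ?q ^ ?q) * (real m * real ?q ^ ?q)"
    using m(2) by (rule mult_left_mono) simp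
  also have "\<dots> = real m * ln 2 / 2" using q by simp
  also have "\<dots> < real m * ln 2" using m(3) by simp
  finally show ?thesis using m(1) by linarith
qed

lemma not_prime_pot_le:
  assumes fin: "finite (carrier R)" and np: "\<not> nonassoc_prime R"
  shows "pot R \<le> ereal (real (card (carrier R) - 1))"
proof -
  let ?q = "card (carrier R)"
  \<comment> \<open>The summand \<open>1\<close> keeps the constant positive for \<open>q = 1\<close>, so that its \<open>n\<close>-th root tends to \<open>1\<close>.\<close>
  let ?c = "2 * (ln (real ?q) + 1)"
  have q: "?q > 0" using fin zero_closed by (auto simp: card_gt_0_iff)
  then have c: "?c > 0" "ln (real ?q) \<ge> 0" by (auto intro: add_nonneg_pos)
  have "root n (ln (real (card (carrier (var_free_ring R n))))) \<le> root n n * root n ?c * real (?q - 1)"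
    if n: "n \<ge> 1" for n
  proof -
    obtain S where S: "determining_set R n S" "card S \<le> (n + 1) * (?q - 1) ^ n"
      using not_prime_determining_set[OF fin np n] by blast
    have nn: "(n + 1) * (?q - 1) ^ n \<le> 2 * n * (?q - 1) ^ n"
      using n by (intro mult_right_mono) auto
    have "ln (real (card (carrier (var_free_ring R n)))) \<le> real (card S) * ln (real ?q)"
      by (rule ln_card_var_free_ring_le[OF fin S(1)])
    also have "\<dots> \<le> real ((n + 1) * (?q - 1) ^ n) * (ln (real ?q) + 1)"
      using S(2) c(2) by (intro mult_mono) (auto simp only: of_nat_le_iff)
    also have "\<dots> \<le> real (2 * n * (?q - 1) ^ n) * (ln (real ?q) + 1)"
      using nn c(2) by (intro mult_right_mono) (auto simp only: of_nat_le_iff)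
    finally have "ln (real (card (carrier (var_free_ring R n)))) \<le> real n * ?c * real (?q - 1) ^ n"
      by (simp add: algebra_simps)
    then have "root n (ln (real (card (carrier (var_free_ring R n))))) \<le>
        root n (real n * ?c * real (?q - 1) ^ n)"
      using n by (simp add: real_root_le_iff)
    also have "\<dots> = root n n * root n ?c * real (?q - 1)"
      using n by (simp only: real_root_mult) (simp add: real_root_power_cancel)
    finally show ?thesis .
  qed
  then have "pot R \<le> limsup (\<lambda>n. ereal (root n n * root n ?c * real (?q - 1)))"
    unfolding pot_def by (intro Limsup_mono eventually_sequentiallyI[of 1]) (simp only: ereal_less_eq)
  moreover have "(\<lambda>n. root n n * root n ?c * real (?q - 1)) \<longlonglongrightarrow> 1 * 1 * real (?q - 1)"
    using c by (intro tendsto_intros LIMSEQ_root LIMSEQ_root_const)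
  then have "limsup (\<lambda>n. ereal (root n n * root n ?c * real (?q - 1))) = ereal (real (?q - 1))"
    by (intro lim_imp_Limsup) auto
  ultimately show ?thesis by simp
qed

lemma prime_pot_eq:
  assumes fin: "finite (carrier R)" and prime: "nonassoc_prime R"
  shows "pot R = ereal (real (card (carrier R)))"
proof -
  let ?q = "card (carrier R)"
  let ?f = "\<lambda>n. ln (real (card (carrier (var_free_ring R n))))"
  let ?c1 = "ln 2 / (2 * real ?q ^ ?q)" and ?c2 = "ln (real ?q) + 1"
  have q: "?q > 0" using fin zero_closed by (auto simp: card_gt_0_iff)
  then have c: "?c1 > 0" "?c2 > 0" by (auto intro: add_nonneg_pos)
  have r: "root n (x * real ?q ^ n) = root n x * real ?q" if "n \<ge> 1" for n x
    using that by (simp only: real_root_mult) (simp add: real_root_power_cancel)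
  have lim: "(\<lambda>n. root n x * real ?q) \<longlonglongrightarrow> real ?q" if "x > 0" for x
    using tendsto_mult_right[OF LIMSEQ_root_const[OF that], of "real ?q"] by simp
  have "(\<lambda>n. root n (?f n)) \<longlonglongrightarrow> real ?q"
  proof (rule tendsto_sandwich[OF _ _ lim[OF c(1)] lim[OF c(2)]])
    show "\<forall>\<^sub>F n in sequentially. root n ?c1 * real ?q \<le> root n (?f n)"
      using prime_ln_card_var_free_ring_lower[OF fin prime]
      by (intro eventually_sequentiallyI[of 1])
        (auto simp: r[symmetric] real_root_le_iff intro: less_imp_le)
    show "\<forall>\<^sub>F n in sequentially. root n (?f n) \<le> root n ?c2 * real ?q"
      using ln_card_var_free_ring_upper[OF fin]
      by (intro eventually_sequentiallyI[of 1])
        (auto simp: r[symmetric] real_root_le_iff intro: less_imp_le)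
  qed
  then show ?thesis unfolding pot_def by (intro lim_imp_Limsup) auto
qed

end

theorem theorem2:
  fixes A :: "('a, 'm) ring_scheme"
  assumes "nonassoc_ring A" and "finite (carrier A)"
  shows "(pot A = ereal (real (card (carrier A))) \<longleftrightarrow> nonassoc_prime A) \<and>
    (nonassoc_prime A \<longrightarrow>
      (\<exists>c1 c2 :: real. c1 > 0 \<and> c2 > 0 \<and>
        (\<forall>n\<ge>1. c1 * real (card (carrier A)) ^ n < ln (real (card (carrier (var_free_ring A n)))) \<and>
                ln (real (card (carrier (var_free_ring A n)))) < c2 * real (card (carrier A)) ^ n)))"
proof -
  interpret A: nonassoc_ring A by fact
  let ?q = "card (carrier A)"
  have q: "?q > 0" using assms(2) A.zero_closed by (auto simp: card_gt_0_iff)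
  have "pot A \<noteq> ereal (real ?q)" if "\<not> nonassoc_prime A"
  proof -
    have "ereal (real (?q - 1)) < ereal (real ?q)" using q by simp
    then show ?thesis using A.not_prime_pot_le[OF assms(2) that] by (metis leD)
  qed
  moreover have "\<exists>c1 c2 :: real. c1 > 0 \<and> c2 > 0 \<and>
      (\<forall>n\<ge>1. c1 * real ?q ^ n < ln (real (card (carrier (var_free_ring A n)))) \<and>
        ln (real (card (carrier (var_free_ring A n)))) < c2 * real ?q ^ n)" if "nonassoc_prime A"
    using A.prime_ln_card_var_free_ring_lower[OF assms(2) that] A.ln_card_var_free_ring_upper[OF assms(2)] q
    by (intro exI[of _ "ln 2 / (2 * real ?q ^ ?q)"] exI[of _ "ln (real ?q) + 1"] conjI allI impI)
      (simp_all add: add_nonneg_pos)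
  ultimately show ?thesis using A.prime_pot_eq[OF assms(2)] by blast
qed

end
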